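(* Let $m > \ell > 0$ and $k \geq 3$ be integers and let $n = km - \ell$. For $1 \leq i \leq k$ let $\mathcal F_i \subset \binom{[n]}{m - \ell} \cup \binom{[n]}{m} \cup \binom{[n]}{m + \ell}$, and suppose that $\mathcal F_1, \dots, \mathcal F_k$ are cross-partition-free. Then $$\sum_{1 \leq i \leq k} \left( \frac{\bigl|\mathcal F_i^{(m - \ell)}\bigr|}{\binom{n}{m - \ell}} + \frac{\bigl|\mathcal F_i^{(m)}\bigr|}{\binom{n}{m}} + (k - 2) \frac{\bigl|\mathcal F_i^{(m + \ell)}\bigr|}{\binom{n}{m + \ell}} \right) \leq (k - 1)k.$$
   Context: $[n] = \{1,2,\dots,n\}$ and $2^{[n]}$ is its power set. $\binom{[n]}{j}$ denotes the set of all $j$-element subsets of $[n]$. For a family $\mathcal F \subset 2^{[n]}$ and $0 \le j \le n$, $\mathcal F^{(j)} = \mathcal F \cap \binom{[n]}{j}$. Families $\mathcal F_1,\dots,\mathcal F_k \subset 2^{[n]}$ (not necessarily distinct) are called cross-partition-free if there is no choice of $F_i \in \mathcal F_i$, $i = 1,\dots,k$, such that $F_1,\dots,F_k$ form a partition of $[n]$ (i.e. are pairwise disjoint with union $[n]$). *)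

theory Defs
  imports Complex_Main "HOL-Library.Disjoint_Sets" "HOL-Library.Ramsey"
begin

text \<open>The set of all \<open>j\<close>-element subsets of \<open>{1..n}\<close> is \<^term>\<open>nsets {1..n} j\<close>.\<close>

definition level :: "nat \<Rightarrow> nat set set \<Rightarrow> nat \<Rightarrow> nat set set" where
  "level n \<F> j = \<F> \<inter> nsets {1..n} j"

text \<open>A partition is taken to be an indexed one: the sets with distinct indices are disjoint.\<close>

definition cross_partition_free :: "nat \<Rightarrow> nat \<Rightarrow> (nat \<Rightarrow> nat set set) \<Rightarrow> bool" where
  "cross_partition_free n k \<F> \<longleftrightarrow>
    \<not> (\<exists>F. (\<forall>i\<in>{1..k}. F i \<in> \<F> i) \<and>
            disjoint_family_on F {1..k} \<and> (\<Union>i\<in>{1..k}. F i) = {1..n})"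

end

theory Submission
  imports Defs "HOL-Combinatorics.Permutations"
begin

text \<open>
  Since \<open>n = k * (m - l) + (k - 1) * l\<close>, the ground set can be cut into \<open>k\<close> cores of size \<open>m - l\<close> and
  \<open>k - 1\<close> increments of size \<open>l\<close>. Give the \<open>i\<close>-th core to the \<open>i\<close>-th family and distribute the
  increments among the cores: a core with no, one or two increments has size \<open>m - l\<close>, \<open>m\<close> or \<open>m + l\<close>,
  and every distribution yields a partition of the ground set. Apply a random permutation to this
  picture. A cross-partition-free system must refuse at least one of the resulting sets in every
  distribution, and the densities in the theorem are the probabilities that a single such set
  belongs to its family. It therefore suffices to bound, for one fixed permutation, the weighted number
  of refusals from below.

  This is a problem about \<open>k\<close> agents (the families) and \<open>N = k - 1\<close> items (the increments). Each agent
  accepts or refuses each set of items. Attach the cost \<open>slot_cost\<close> to every pair of an agent and an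
  item \<open>j\<close>: one unit for refusing \<open>{}\<close>, one for refusing \<open>{j}\<close>, and one for every \<open>h\<close> such that \<open>{j, h}\<close>
  is refused. In the random picture an agent's expected cost for a single \<open>j\<close> weights the three missing
  densities by \<open>1\<close>, \<open>1\<close> and \<open>k - 2\<close>, exactly as in the theorem. What has to be shown is
  that all items can be distributed among accepting agents as soon as the total cost is less than
  \<open>(N + 1) * N\<close>; this is \<open>assignment_if_cheap\<close>.

  No fractional count of distributions gives this bound in general, because the corresponding linear
  program has an integrality gap, so the distribution is constructed. One agent who accepts nothing is
  set aside, the others own one item each, and \<open>transfer_assignment\<close> repairs the resulting distribution:
  owners who refuse their own item either give it away or take a second one. A cyclic rotation
  of the ownership makes the cost small enough for this, by averaging.
\<close>

section \<open>Repairing a one-to-one distribution by transfers\<close>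

text \<open>
  Every vertex \<open>v\<close> starts with one item, itself. The set \<open>A\<close> contains the vertices that must not end
  with nothing, \<open>B\<close> those that must not end with just their own item, and \<open>D\<close> the arcs \<open>(v, w)\<close> along
  which \<open>v\<close> must not receive the item of \<open>w\<close> on top of its own. So the vertices of \<open>B\<close> have to be
  covered by disjoint transfers, each from a giver outside \<open>A\<close> to a taker along an arc outside \<open>D\<close>.

  The induction removes one transfer at a time; the cost bound survives if the removed pair of vertices
  carries at least two units of the cost \<open>card A + card B + card D\<close>. Call a vertex outside \<open>A\<close> and \<open>B\<close> free. The
  cost bound provides at least \<open>card (A \<inter> B) + card D\<close> free vertices, which is enough to find a giver
  whenever two vertices of \<open>B\<close> cannot be paired with each other. The parity assumption excludes
  the one real obstruction: an odd number of vertices all of which lie in \<open>B\<close>.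
\<close>

lemma transfer_assignment:
  fixes ok :: "'a \<Rightarrow> 'a set \<Rightarrow> bool"
  assumes "finite V"
    and "card (A \<inter> V) + card (B \<inter> V) + card (D \<inter> V \<times> V) \<le> card V"
    and "V \<subseteq> B \<Longrightarrow> even (card V)"
    and okA: "\<And>v. v \<notin> A \<Longrightarrow> ok v {}"
    and okB: "\<And>v. v \<notin> B \<Longrightarrow> ok v {v}"
    and okD: "\<And>v w. v \<noteq> w \<Longrightarrow> (v, w) \<notin> D \<Longrightarrow> ok v {v, w}"
  shows "\<exists>S. (\<forall>v\<in>V. ok v (S v)) \<and> disjoint_family_on S V \<and> (\<Union>v\<in>V. S v) = V"
  using assms(1-3)
proof (induction "card V" arbitrary: V rule: less_induct)
  case less
  note fin = less.prems(1) and cost = less.prems(2) and parity = less.prems(3)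
  let ?sol = "\<lambda>V. \<exists>S. (\<forall>v\<in>V. ok v (S v)) \<and> disjoint_family_on S V \<and> (\<Union>v\<in>V. S v) = V"
  let ?F = "V - A - B"
  have finD: "finite (D \<inter> V \<times> V)" using fin by auto
  have own: "?sol W" if "W \<inter> B = {}" for W
    using that okB by (intro exI[of _ "\<lambda>v. {v}"]) (auto simp: disjoint_family_on_def)
  have give: "?sol V"
    if vw: "v \<in> V" "w \<in> V" "v \<noteq> w" "w \<notin> A" "(v, w) \<notin> D" and rest: "?sol (V - {v, w})" for v w
  proof -
    obtain S where S: "\<forall>u\<in>V - {v, w}. ok u (S u)" "disjoint_family_on S (V - {v, w})"
        "(\<Union>u\<in>V - {v, w}. S u) = V - {v, w}"
      using rest by blast
    have sub: "S u \<inter> {v, w} = {}" if "u \<in> V" "u \<noteq> v" "u \<noteq> w" for u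
      using S(3) that by blast
    let ?S = "S(v := {v, w}, w := {})"
    have "\<forall>u\<in>V. ok u (?S u)" using S(1) vw okA okD by auto
    moreover have "disjoint_family_on ?S V"
      using S(2) sub vw(3) unfolding disjoint_family_on_def by auto
    moreover have "(\<Union>u\<in>V. ?S u) = {v, w} \<union> (\<Union>u\<in>V - {v, w}. S u)"
      using vw by (auto split: if_splits)
    ultimately show ?thesis using S(3) vw(1,2) by (intro exI[of _ ?S]) auto
  qed
  have shrink: "?sol V"
    if vw: "v \<in> V" "w \<in> V" "v \<noteq> w" "w \<notin> A" "(v, w) \<notin> D"
      and cost': "card (A \<inter> (V - {v, w})) + card (B \<inter> (V - {v, w})) + card (D \<inter> (V - {v, w}) \<times> (V - {v, w})) + 2 \<le> card V"
      and parity': "V - {v, w} \<subseteq> B \<Longrightarrow> even (card (V - {v, w}))" for v w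
  proof (rule give[OF vw])
    have "card (V - {v, w}) = card V - 2" using vw fin by (simp add: card_Diff_subset)
    moreover have "card {v, w} \<le> card V" using vw fin by (intro card_mono) auto
    ultimately show "?sol (V - {v, w})"
      using vw fin cost' parity' by (intro less.hyps) auto
  qed
  have D_le: "card (D \<inter> (V - X) \<times> (V - X)) \<le> card (D \<inter> V \<times> V)" for X
    using finD by (intro card_mono) auto
  have D_less: "card (D \<inter> (V - X) \<times> (V - X)) < card (D \<inter> V \<times> V)"
    if "(v, w) \<in> D" "v \<in> V" "w \<in> V" "v \<in> X \<or> w \<in> X" for X v w
    using that finD by (intro psubset_card_mono) auto
  have A_le: "card (A \<inter> (V - X)) \<le> card (A \<inter> V)" for X
    using fin by (intro card_mono) auto
  have removed: "card (Y \<inter> (V - {v, w})) = card (Y \<inter> V) - card (Y \<inter> {v, w})"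
    "card (Y \<inter> {v, w}) \<le> card (Y \<inter> V)" if "v \<in> V" "w \<in> V" for Y v w
  proof -
    have "Y \<inter> (V - {v, w}) = (Y \<inter> V) - (Y \<inter> {v, w})" by auto
    then show "card (Y \<inter> (V - {v, w})) = card (Y \<inter> V) - card (Y \<inter> {v, w})"
      using that by (simp only:) (intro card_Diff_subset, auto)
    show "card (Y \<inter> {v, w}) \<le> card (Y \<inter> V)" using that fin by (intro card_mono) auto
  qed
  have F_large: "card (A \<inter> B \<inter> V) + card (D \<inter> V \<times> V) \<le> card ?F"
  proof -
    have "card (A \<inter> V) + card (B \<inter> V) = card (A \<inter> V \<union> B \<inter> V) + card ((A \<inter> V) \<inter> (B \<inter> V))"
      using fin by (intro card_Un_Int) auto
    moreover have "(A \<inter> V) \<inter> (B \<inter> V) = A \<inter> B \<inter> V" by auto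
    moreover have "card V = card (A \<inter> V \<union> B \<inter> V) + card ?F"
      using fin by (subst card_Un_disjoint[symmetric]) (auto intro: arg_cong[where f = card])
    ultimately show ?thesis using cost by simp
  qed
  have giver: "\<exists>h\<in>?F. (v, h) \<notin> D"
    if "v \<in> V" and less: "card (D \<inter> V \<times> V) < card ?F \<or> (\<exists>w\<in>V - ?F. (v, w) \<in> D)
      \<and> card (D \<inter> V \<times> V) \<le> card ?F" for v
  proof (rule ccontr)
    assume "\<not> ?thesis"
    then have sub: "Pair v ` ?F \<subseteq> D \<inter> V \<times> V" using \<open>v \<in> V\<close> by auto
    have card: "card (Pair v ` ?F) = card ?F" by (rule card_image) (auto simp: inj_on_def)
    have "card ?F \<le> card (D \<inter> V \<times> V)" using card_mono[OF finD sub] card by simp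
    then obtain w where w: "w \<in> V - ?F" "(v, w) \<in> D" "card (D \<inter> V \<times> V) \<le> card ?F"
      using less by (meson not_less)
    have "(v, w) \<in> D \<inter> V \<times> V" "(v, w) \<notin> Pair v ` ?F" using w(1,2) \<open>v \<in> V\<close> by auto
    then have "Pair v ` ?F \<noteq> D \<inter> V \<times> V" by metis
    with sub have "Pair v ` ?F \<subset> D \<inter> V \<times> V" by (rule psubsetI)
    then have "card (Pair v ` ?F) < card (D \<inter> V \<times> V)" by (rule psubset_card_mono[OF finD])
    then show False using card w(3) by linarith
  qed
  have no_parity: "even (card W)"
    if "W \<subseteq> B" "W \<subseteq> A" "card (A \<inter> W) + card (B \<inter> W) \<le> card W" for W
    using that by (simp add: Int_absorb1)
  have sz: "card {v, w} = 2" if "v \<noteq> w" for v w :: 'a using that by simp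
  \<comment> \<open>Vertices of \<open>B - A\<close> can both give and take, so two of them cover each other unless both arcs
    between them are forbidden. A single leftover is where the parity assumption is needed.\<close>
  consider "B \<inter> V = {}"
    | (two) z z' where "z \<in> B \<inter> V - A" "z' \<in> B \<inter> V - A" "z \<noteq> z'"
    | (one) z where "B \<inter> V - A = {z}"
    | (none) p where "p \<in> B \<inter> V" "B \<inter> V \<subseteq> A"
  proof (cases "B \<inter> V - A = {}")
    case True
    then show ?thesis using that(1,4) by (metis Diff_eq_empty_iff ex_in_conv)
  next
    case False
    then obtain z where z: "z \<in> B \<inter> V - A" by (meson ex_in_conv)
    show ?thesis
    proof (cases "B \<inter> V - A = {z}")
      case True
      then show ?thesis by (rule that(3))
    next
      case False
      then obtain z' where "z' \<in> B \<inter> V - A" "z \<noteq> z'" using z by auto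
      then show ?thesis using z that(2) by metis
    qed
  qed
  then show ?case
  proof cases
    case 1
    show ?thesis by (rule own) (use 1 in auto)
  next
    case two
    show ?thesis
    proof (cases "(z, z') \<in> D \<and> (z', z) \<in> D")
      case False
      have *: "?sol V" if "z \<in> B \<inter> V - A" "z' \<in> B \<inter> V - A" "z \<noteq> z'" "(z, z') \<notin> D" for z z'
      proof (rule shrink)
        have "B \<inter> {z, z'} = {z, z'}" using that by auto
        then have "card (B \<inter> (V - {z, z'})) = card (B \<inter> V) - 2" "2 \<le> card (B \<inter> V)"
          using removed[of z z' B] that sz by auto
        then show "card (A \<inter> (V - {z, z'})) + card (B \<inter> (V - {z, z'}))
            + card (D \<inter> (V - {z, z'}) \<times> (V - {z, z'})) + 2 \<le> card V"
          using cost D_le[of "{z, z'}"] A_le[of "{z, z'}"] by linarith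
        show "even (card (V - {z, z'}))" if "V - {z, z'} \<subseteq> B"
          using that parity \<open>z \<in> B \<inter> V - A\<close> \<open>z' \<in> B \<inter> V - A\<close> \<open>z \<noteq> z'\<close> fin
          by (auto simp: card_Diff_subset)
      qed (use that in auto)
      show ?thesis
      proof (cases "(z, z') \<in> D")
        case True
        then have "(z', z) \<notin> D" using False by simp
        then show ?thesis by (rule *[OF two(2,1) two(3)[symmetric]])
      next
        case False
        then show ?thesis by (rule *[OF two])
      qed
    next
      case True
      \<comment> \<open>Both arcs are forbidden, so there are at least two free vertices, and one of the two arcs
        already leaves \<open>z\<close> towards a vertex that is not free: some free vertex can give to \<open>z\<close>. Removing
        \<open>z\<close> saves one unit from \<open>B\<close> and one from \<open>D\<close>, and another free vertex remains.\<close>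
      have two_arcs: "2 \<le> card (D \<inter> V \<times> V)"
        using True two card_mono[OF finD, of "{(z, z'), (z', z)}"] by auto
      obtain h where h: "h \<in> ?F" "(z, h) \<notin> D"
        using giver[of z] True two F_large by auto
      have "card (?F - {h}) = card ?F - 1" using h by simp
      then have "card (?F - {h}) \<noteq> 0" using two_arcs F_large by linarith
      then have other: "?F - {h} \<noteq> {}" by (metis card.empty)
      show ?thesis
      proof (rule shrink)
        have "B \<inter> {z, h} = {z}" using h two by auto
        then have "card (B \<inter> (V - {z, h})) = card (B \<inter> V) - 1" "1 \<le> card (B \<inter> V)"
          using removed[of z h B] two h by auto
        moreover have "card (D \<inter> (V - {z, h}) \<times> (V - {z, h})) < card (D \<inter> V \<times> V)"
          using True two by (intro D_less[of z z']) auto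
        ultimately show "card (A \<inter> (V - {z, h})) + card (B \<inter> (V - {z, h}))
            + card (D \<inter> (V - {z, h}) \<times> (V - {z, h})) + 2 \<le> card V"
          using cost A_le[of "{z, h}"] by linarith
        show "even (card (V - {z, h}))" if "V - {z, h} \<subseteq> B"
          using that other two by auto
      qed (use h two in auto)
    qed
  next
    case one
    then have z: "z \<in> B" "z \<in> V" "z \<notin> A" by auto
    show ?thesis
    proof (cases "A \<inter> B \<inter> V = {}")
      case True
      then have Bz: "B \<inter> V = {z}" using one by auto
      have rest: "?sol (V - {v, w})" if "z \<in> {v, w}" for v w
        using Bz that by (intro own) auto
      show ?thesis
      proof (cases "\<exists>i\<in>V - {z}. (i, z) \<notin> D")
        case True
        then obtain i where i: "i \<in> V" "i \<noteq> z" "(i, z) \<notin> D" by auto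
        show ?thesis by (rule give[OF i(1) z(2) i(2) z(3) i(3)]) (rule rest, simp)
      next
        case False
        \<comment> \<open>All arcs into \<open>z\<close> are forbidden. Together with \<open>z\<close> itself they use up the whole cost, so
          everybody else can give to \<open>z\<close>.\<close>
        have "V \<noteq> {z}" using parity z by auto
        then obtain i where i: "i \<in> V" "i \<noteq> z" using z by auto
        have sub: "(\<lambda>i. (i, z)) ` (V - {z}) \<subseteq> D \<inter> V \<times> V" using False z by auto
        have card: "card ((\<lambda>i. (i, z)) ` (V - {z})) = card V - 1"
          using z by (subst card_image) (auto simp: inj_on_def)
        have pos: "card V > 0" using z fin card_gt_0_iff by blast
        have "card V - 1 \<le> card (D \<inter> V \<times> V)" using card_mono[OF finD sub] card by simp
        then have "card (A \<inter> V) = 0" "card (D \<inter> V \<times> V) \<le> card V - 1"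
          using cost Bz pos by auto
        then have iA: "i \<notin> A" and D: "D \<inter> V \<times> V = (\<lambda>i. (i, z)) ` (V - {z})"
          using fin i card card_seteq[OF finD sub] by auto
        have "(z, i) \<notin> (\<lambda>i. (i, z)) ` (V - {z})" using i by auto
        then have "(z, i) \<notin> D" using D z i by blast
        then show ?thesis by (intro give[OF z(2) i(1) i(2)[symmetric] iA] rest) auto
      qed
    next
      case False
      then obtain p where p: "p \<in> A" "p \<in> B" "p \<in> V" by blast
      show ?thesis
      proof (cases "(p, z) \<in> D")
        case False
        \<comment> \<open>Once \<open>z\<close> is gone, \<open>B\<close> lies inside \<open>A\<close>, and then the cost bound prevents \<open>B\<close> from filling
          a nonempty vertex set; parity is no longer an issue.\<close>
        have pz: "p \<noteq> z" using p z by auto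
        have A1: "A \<inter> {p, z} = {p}" and B2: "B \<inter> {p, z} = {p, z}" using p z by auto
        have cost': "card (A \<inter> (V - {p, z})) + card (B \<inter> (V - {p, z}))
            + card (D \<inter> (V - {p, z}) \<times> (V - {p, z})) + 2 \<le> card V"
          using removed[of p z A] removed[of p z B] A1 B2 sz[OF pz] p z cost D_le[of "{p, z}"] by simp
        show ?thesis
        proof (rule shrink[OF _ _ pz _ False cost'])
          assume sub: "V - {p, z} \<subseteq> B"
          then have "V - {p, z} \<subseteq> A" using one by auto
          moreover have "card (V - {p, z}) = card V - 2" using p z pz fin by (simp add: card_Diff_subset)
          ultimately show "even (card (V - {p, z}))"
            using sub cost' by (intro no_parity) linarith+
        qed (use p z in auto)
      next
        case True
        have "card (A \<inter> B \<inter> V) > 0" using p fin by (auto simp: card_gt_0_iff)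
        then obtain h where h: "h \<in> ?F" "(z, h) \<notin> D"
          using giver[of z] z F_large by auto
        have zh: "z \<noteq> h" using h z by auto
        have B1: "B \<inter> {z, h} = {z}" using h z by auto
        have "card (D \<inter> (V - {z, h}) \<times> (V - {z, h})) < card (D \<inter> V \<times> V)"
          using True p z by (intro D_less[of p z]) auto
        then have cost': "card (A \<inter> (V - {z, h})) + card (B \<inter> (V - {z, h}))
            + card (D \<inter> (V - {z, h}) \<times> (V - {z, h})) + 2 \<le> card V"
          using removed[of z h B] B1 h z cost A_le[of "{z, h}"] by simp
        show ?thesis
        proof (rule shrink[OF _ _ zh _ _ cost'])
          assume sub: "V - {z, h} \<subseteq> B"
          then have "V - {z, h} \<subseteq> A" using one by auto
          moreover have "card (V - {z, h}) = card V - 2" using h z zh fin by (simp add: card_Diff_subset)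
          ultimately show "even (card (V - {z, h}))"
            using sub cost' by (intro no_parity) linarith+
        qed (use h z in auto)
      qed
    qed
  next
    case none
    have "card (A \<inter> B \<inter> V) > 0" using none fin by (auto simp: card_gt_0_iff)
    then obtain h where h: "h \<in> ?F" "(p, h) \<notin> D"
      using giver[of p] none F_large by auto
    have ph: "p \<noteq> h" using h none by auto
    have A1: "A \<inter> {p, h} = {p}" and B1: "B \<inter> {p, h} = {p}" using none h by auto
    have cost': "card (A \<inter> (V - {p, h})) + card (B \<inter> (V - {p, h}))
        + card (D \<inter> (V - {p, h}) \<times> (V - {p, h})) + 2 \<le> card V"
      using removed[of p h A] removed[of p h B] A1 B1 none h cost D_le[of "{p, h}"] by simp
    show ?thesis
    proof (rule shrink[OF _ _ ph _ _ cost'])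
      assume sub: "V - {p, h} \<subseteq> B"
      then have "V - {p, h} \<subseteq> A" using none by auto
      moreover have "card (V - {p, h}) = card V - 2" using h none ph fin by (simp add: card_Diff_subset)
      ultimately show "even (card (V - {p, h}))"
        using sub cost' by (intro no_parity) linarith+
    qed (use h none in auto)
  qed
qed

section \<open>Distributing items among one more agent than items\<close>

lemma bij_betw_rotation:
  fixes s N :: nat
  assumes "s < N"
  shows "bij_betw (\<lambda>j. (j + s) mod N) {..<N} {..<N}"
proof -
  have rot: "(j + s) mod N = (if j + s < N then j + s else j + s - N)" if "j < N" for j
    using that assms by (simp add: mod_if)
  have "inj_on (\<lambda>j. (j + s) mod N) {..<N}"
    by (rule inj_onI) (use assms in \<open>auto simp: rot split: if_splits\<close>)
  moreover have "(\<lambda>j. (j + s) mod N) ` {..<N} \<subseteq> {..<N}" using assms by auto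
  ultimately show ?thesis by (simp add: bij_betw_def endo_inj_surj)
qed

text \<open>
  Agent \<open>i\<close>, when its own item is \<open>j\<close>, is charged for refusing to hold nothing, for refusing \<open>{j}\<close>, and
  for each second item that it refuses to hold together with \<open>j\<close>. Summed over \<open>j\<close>, a refused pair is
  charged twice, once from each of its items.
\<close>

definition slot_cost :: "nat \<Rightarrow> ('i \<Rightarrow> nat set \<Rightarrow> bool) \<Rightarrow> 'i \<Rightarrow> nat \<Rightarrow> nat" where
  "slot_cost N ok i j = of_bool (\<not> ok i {}) + of_bool (\<not> ok i {j})
     + (\<Sum>h\<in>{..<N} - {j}. of_bool (\<not> ok i {j, h}))"

text \<open>
  There is one agent more than there are items. If every agent refused to hold nothing, this alone
  would cost \<open>Suc N * N\<close>; so some agent \<open>z\<close> accepts nothing and is put aside. The other \<open>N\<close> agents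
  own one item each, according to one of the \<open>N\<close> cyclic shifts of a fixed bijection. The shifts
  partition the pairs of an agent and an item, so on average a shift is cheap enough for
  \<open>transfer_assignment\<close>. If parity obstructs the transfers, then every owner refuses its own item and
  no budget is left for anything else; in that case \<open>z\<close> accepts some single item \<open>x\<close>, takes it, and an
  even number of owners remains.
\<close>

lemma assignment_if_cheap:
  fixes ok :: "'i \<Rightarrow> nat set \<Rightarrow> bool" and N :: nat
  assumes fin: "finite I" and card: "card I = Suc N"
    and cheap: "(\<Sum>i\<in>I. \<Sum>j<N. slot_cost N ok i j) < Suc N * N"
  shows "\<exists>S. (\<forall>i\<in>I. ok i (S i)) \<and> disjoint_family_on S I \<and> (\<Union>i\<in>I. S i) = {..<N}"
proof -
  have "\<exists>z\<in>I. ok z {}"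
  proof (rule ccontr)
    assume "\<not> ?thesis"
    then have "(\<Sum>j<N. 1) \<le> (\<Sum>j<N. slot_cost N ok i j)" if "i \<in> I" for i
      using that by (intro sum_mono) (simp add: slot_cost_def)
    then have "(\<Sum>i\<in>I. \<Sum>j<N. 1) \<le> (\<Sum>i\<in>I. \<Sum>j<N. slot_cost N ok i j)"
      by (rule sum_mono)
    then show False using cheap card by simp
  qed
  then obtain z where z: "z \<in> I" "ok z {}" by blast
  obtain g where g: "bij_betw g {..<N} (I - {z})"
    using ex_bij_betw_nat_finite[of "I - {z}"] fin card z by (auto simp: lessThan_atLeast0)
  define own where "own s j = g ((j + s) mod N)" for s j
  have own_bij: "bij_betw (own s) {..<N} (I - {z})" if "s < N" for s
    using bij_betw_trans[OF bij_betw_rotation[OF that] g] by (simp add: own_def[abs_def] comp_def)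
  have all_owners: "(\<Sum>s<N. f (own s j)) = (\<Sum>i\<in>I - {z}. f i)" if "j < N" for f :: "'i \<Rightarrow> nat" and j
  proof -
    have "bij_betw (\<lambda>s. own s j) {..<N} (I - {z})"
      using bij_betw_trans[OF bij_betw_rotation[OF that] g]
      by (simp add: own_def comp_def add.commute)
    then show ?thesis by (rule sum.reindex_bij_betw)
  qed
  define cost where "cost s = (\<Sum>j<N. slot_cost N ok (own s j) j)" for s
  have "(\<Sum>s<N. cost s) = (\<Sum>j<N. \<Sum>s<N. slot_cost N ok (own s j) j)"
    unfolding cost_def by (rule sum.swap)
  also have "\<dots> = (\<Sum>j<N. \<Sum>i\<in>I - {z}. slot_cost N ok i j)"
    by (intro sum.cong refl all_owners) simp
  also have "\<dots> = (\<Sum>i\<in>I - {z}. \<Sum>j<N. slot_cost N ok i j)" by (rule sum.swap)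
  finally have total: "(\<Sum>s<N. cost s) + (\<Sum>j<N. slot_cost N ok z j) < Suc N * N"
    using cheap z fin by (simp add: sum.remove[of I z])
  define A where "A s = {j. \<not> ok (own s j) {}}" for s
  define B where "B s = {j. \<not> ok (own s j) {j}}" for s
  define D where "D s = {(j, h). j \<noteq> h \<and> \<not> ok (own s j) {j, h}}" for s
  have cost_eq: "cost s = card (A s \<inter> {..<N}) + card (B s \<inter> {..<N}) + card (D s \<inter> {..<N} \<times> {..<N})"
    for s
  proof -
    have "D s \<inter> {..<N} \<times> {..<N} = (SIGMA j:{..<N}. {h \<in> {..<N} - {j}. \<not> ok (own s j) {j, h}})"
      by (auto simp: D_def)
    then have "card (D s \<inter> {..<N} \<times> {..<N})
        = (\<Sum>j<N. \<Sum>h\<in>{..<N} - {j}. of_bool (\<not> ok (own s j) {j, h}))"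
      by (simp add: sum_of_bool_eq Int_def)
    moreover have "card (A s \<inter> {..<N}) = (\<Sum>j<N. of_bool (\<not> ok (own s j) {}))"
      "card (B s \<inter> {..<N}) = (\<Sum>j<N. of_bool (\<not> ok (own s j) {j}))"
      by (simp_all add: A_def B_def sum_of_bool_eq Int_def conj_commute)
    ultimately show ?thesis
      by (simp add: cost_def slot_cost_def sum.distrib)
  qed
  \<comment> \<open>The agent \<open>z\<close> takes the items of \<open>X\<close> from their owners, who get nothing; the other owners
    redistribute their items among themselves.\<close>
  have extend: ?thesis
    if s: "s < N" and X: "ok z X" "X \<subseteq> {..<N}" "X \<inter> A s = {}"
      and sol: "\<exists>S. (\<forall>j\<in>{..<N} - X. ok (own s j) (S j)) \<and> disjoint_family_on S ({..<N} - X)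
        \<and> (\<Union>j\<in>{..<N} - X. S j) = {..<N} - X" for s X
  proof -
    obtain S where S: "\<forall>j\<in>{..<N} - X. ok (own s j) (S j)" "disjoint_family_on S ({..<N} - X)"
        "(\<Union>j\<in>{..<N} - X. S j) = {..<N} - X"
      using sol by blast
    define q where "q = inv_into {..<N} (own s)"
    have q: "bij_betw q (I - {z}) {..<N}"
      using own_bij[OF s] unfolding q_def by (rule bij_betw_inv_into)
    have own_q: "own s (q i) = i" if "i \<in> I - {z}" for i
      using own_bij[OF s] that unfolding q_def by (simp add: bij_betw_inv_into_right)
    define S' where "S' j = (if j \<in> X then {} else S j)" for j
    define T where "T i = (if i = z then X else S' (q i))" for i
    have qN: "q i < N" if "i \<in> I - {z}" for i using q that by (auto simp: bij_betw_def)
    have q_inj: "q i \<noteq> q i'" if "i \<in> I - {z}" "i' \<in> I - {z}" "i \<noteq> i'" for i i'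
      using q that by (auto simp: bij_betw_def inj_on_def)
    have S'_disj: "S' j \<inter> S' j' = {}" if "j < N" "j' < N" "j \<noteq> j'" for j j'
      using S(2) that by (auto simp: S'_def disjoint_family_on_def)
    have S'_sub: "S' j \<inter> X = {}" if "j < N" for j
      using S(3) that by (auto simp: S'_def)
    have "ok i (T i)" if "i \<in> I" for i
    proof (cases "i = z")
      case False
      then have i: "i \<in> I - {z}" using that by simp
      have "ok (own s (q i)) (S' (q i))"
        using S(1) X(3) qN[OF i] by (auto simp: S'_def A_def)
      then show ?thesis using own_q[OF i] False by (simp add: T_def)
    qed (simp add: T_def X)
    moreover have "disjoint_family_on T I"
      unfolding disjoint_family_on_def
    proof (intro ballI impI)
      fix i i' assume ii: "i \<in> I" "i' \<in> I" "i \<noteq> i'"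
      show "T i \<inter> T i' = {}"
        using ii S'_disj[of "q i" "q i'"] q_inj[of i i'] qN[of i] qN[of i'] S'_sub[of "q i"] S'_sub[of "q i'"]
        by (cases "i = z"; cases "i' = z") (auto simp: T_def)
    qed
    moreover have "(\<Union>i\<in>I. T i) = {..<N}"
    proof -
      have "(\<Union>i\<in>I. T i) = T z \<union> (\<Union>i\<in>I - {z}. T i)" using z by blast
      also have "(\<Union>i\<in>I - {z}. T i) = (\<Union>i\<in>I - {z}. S' (q i))" by (simp add: T_def)
      also have "\<dots> = (\<Union>j<N. S' j)"
        using q by (metis bij_betw_def image_image)
      also have "\<dots> = (\<Union>j\<in>{..<N} - X. S j)" by (auto simp: S'_def split: if_splits)
      finally show ?thesis using S(3) X(2) by (auto simp: T_def)
    qed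
    ultimately show ?thesis by blast
  qed
  have transfer: "\<exists>S. (\<forall>j\<in>V. ok (own s j) (S j)) \<and> disjoint_family_on S V \<and> (\<Union>j\<in>V. S j) = V"
    if "finite V" "card (A s \<inter> V) + card (B s \<inter> V) + card (D s \<inter> V \<times> V) \<le> card V"
      "V \<subseteq> B s \<Longrightarrow> even (card V)" for s V
    using that by (rule transfer_assignment) (auto simp: A_def B_def D_def)
  show ?thesis
  proof (cases "\<exists>s<N. cost s < N")
    case True
    then obtain s where s: "s < N" "cost s < N" by blast
    have "\<not> {..<N} \<subseteq> B s"
    proof
      assume "{..<N} \<subseteq> B s"
      then have "B s \<inter> {..<N} = {..<N}" by blast
      then show False using s cost_eq[of s] by simp
    qed
    then show ?thesis
      using s z(2) transfer[of "{..<N}" s] cost_eq[of s] by (intro extend[of s "{}"]) auto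
  next
    case False
    then have "(\<Sum>s<N. N) \<le> (\<Sum>s<N. cost s)" by (intro sum_mono) auto
    \<comment> \<open>The shifts alone now cost at least \<open>N * N\<close>, which leaves less than \<open>N\<close> for \<open>z\<close>.\<close>
    then have "(\<Sum>j<N. slot_cost N ok z j) < N" using total by simp
    then have "\<exists>x<N. slot_cost N ok z x = 0"
      using sum_mono[of "{..<N}" "\<lambda>_. 1" "slot_cost N ok z"] by force
    then obtain x where x: "x < N" "ok z {x}" by (auto simp: slot_cost_def)
    have "\<exists>s<N. cost s \<le> N"
    proof (rule ccontr)
      assume "\<not> ?thesis"
      then have "(\<Sum>s<N. Suc N) \<le> (\<Sum>s<N. cost s)" by (intro sum_mono) (auto simp: not_le)
      then show False using total by simp
    qed
    then obtain s where s: "s < N" "cost s \<le> N" by blast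
    show ?thesis
    proof (cases "{..<N} \<subseteq> B s \<and> odd N")
      case False
      then show ?thesis
        using s z(2) transfer[of "{..<N}" s] cost_eq[of s] by (intro extend[of s "{}"]) auto
    next
      case True
      \<comment> \<open>The refusals of the own items exhaust the cost \<open>N\<close>, so any further transfer is allowed.\<close>
      then have "B s \<inter> {..<N} = {..<N}" by blast
      then have "card (A s \<inter> {..<N}) = 0" "card (D s \<inter> {..<N} \<times> {..<N}) = 0"
        using s cost_eq[of s] by auto
      then have empty: "A s \<inter> {..<N} = {}" "D s \<inter> {..<N} \<times> {..<N} = {}" by auto
      let ?V = "{..<N} - {x}"
      have V: "A s \<inter> ?V = {}" "D s \<inter> ?V \<times> ?V = {}" using empty by blast+
      have "card (B s \<inter> ?V) \<le> card ?V" by (intro card_mono) auto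
      moreover have "even (card ?V)" using True x by simp
      ultimately show ?thesis
        using x s empty(1) V by (intro extend[OF s(1) x(2)] transfer) auto
    qed
  qed
qed

section \<open>Averages over permutations\<close>

lemma exists_permutation_mapping_subset:
  assumes "finite U" "X \<subseteq> U" "Y \<subseteq> U" "card X = card Y"
  shows "\<exists>\<tau>. \<tau> permutes U \<and> \<tau> ` X = Y"
proof -
  have fin: "finite X" "finite Y" using assms finite_subset by auto
  obtain f where f: "bij_betw f X Y"
    using finite_same_card_bij[OF fin assms(4)] by blast
  have "card (U - X) = card (U - Y)" using assms fin by (simp add: card_Diff_subset)
  then obtain g where g: "bij_betw g (U - X) (U - Y)"
    using finite_same_card_bij[of "U - X" "U - Y"] assms(1) by blast
  define \<tau> where "\<tau> u = (if u \<in> X then f u else if u \<in> U then g u else u)" for u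
  have X: "bij_betw \<tau> X Y" using f by (rule bij_betw_cong[THEN iffD1, rotated]) (simp add: \<tau>_def)
  have "bij_betw \<tau> (U - X) (U - Y)"
    using g by (rule bij_betw_cong[THEN iffD1, rotated]) (simp add: \<tau>_def)
  then have "bij_betw \<tau> (X \<union> (U - X)) (Y \<union> (U - Y))"
    using X by (intro bij_betw_combine) auto
  moreover have "X \<union> (U - X) = U" "Y \<union> (U - Y) = U" using assms by auto
  ultimately have "\<tau> permutes U"
    by (intro bij_imp_permutes) (use assms(2) in \<open>auto simp: \<tau>_def\<close>)
  then show ?thesis using X by (auto simp: bij_betw_def)
qed

lemma permutes_image_mem_nsets:
  assumes "\<sigma> permutes U" "X \<subseteq> U" "finite U"
  shows "\<sigma> ` X \<in> nsets U (card X)"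
  using assms permutes_image[OF assms(1)] card_image[OF permutes_inj_on[OF assms(1), of X]]
    finite_subset[OF assms(2,3)]
  by (auto simp: nsets_def)

text \<open>The number of permutations carrying \<open>X\<close> onto \<open>Y\<close> does not depend on \<open>Y\<close>: composition with
  a permutation carrying \<open>Y\<close> onto \<open>Y'\<close> injects the one set of permutations into the other.\<close>

lemma card_permutations_mapping_subset:
  assumes "finite U" "X \<subseteq> U" "Y \<subseteq> U" "card Y = card X"
  shows "card {\<sigma>. \<sigma> permutes U \<and> \<sigma> ` X = Y} * (card U choose card X) = fact (card U)"
proof -
  let ?P = "\<lambda>Z. {\<sigma>. \<sigma> permutes U \<and> \<sigma> ` X = Z}"
  have fin: "finite (?P Z)" for Z
    by (rule finite_subset[OF _ finite_permutations[OF assms(1)]]) auto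
  have le: "card (?P Z) \<le> card (?P Z')" if "Z \<subseteq> U" "Z' \<subseteq> U" "card Z = card Z'" for Z Z'
  proof -
    obtain \<tau> where \<tau>: "\<tau> permutes U" "\<tau> ` Z = Z'"
      using exists_permutation_mapping_subset[OF assms(1) \<open>Z \<subseteq> U\<close> \<open>Z' \<subseteq> U\<close>] \<open>card Z = card Z'\<close> by blast
    have "inj_on ((\<circ>) \<tau>) (?P Z)"
      using permutes_inj[OF \<tau>(1)] by (auto simp: inj_on_def fun_eq_iff)
    moreover have "(\<circ>) \<tau> ` ?P Z \<subseteq> ?P Z'"
      using \<tau> by (auto simp: permutes_compose image_comp[symmetric])
    ultimately show ?thesis using fin by (intro card_inj_on_le)
  qed
  have "fact (card U) = card {\<sigma>. \<sigma> permutes U}"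
    using card_permutations[OF refl assms(1)] by simp
  also have "{\<sigma>. \<sigma> permutes U} = (\<Union>Z\<in>nsets U (card X). ?P Z)"
  proof (intro equalityI subsetI)
    fix \<sigma> assume "\<sigma> \<in> {\<sigma>. \<sigma> permutes U}"
    then have \<sigma>: "\<sigma> permutes U" by simp
    have "\<sigma> ` X \<in> nsets U (card X)"
      using \<sigma> assms by (intro permutes_image_mem_nsets)
    then show "\<sigma> \<in> (\<Union>Z\<in>nsets U (card X). ?P Z)" using \<sigma> by auto
  qed auto
  also have "card \<dots> = (\<Sum>Z\<in>nsets U (card X). card (?P Z))"
    using fin assms(1) by (intro card_UN_disjoint) (auto simp: finite_imp_finite_nsets)
  also have "\<dots> = (\<Sum>Z\<in>nsets U (card X). card (?P Y))"
    using assms by (intro sum.cong refl antisym le) (auto simp: nsets_def)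
  also have "\<dots> = (card U choose card X) * card (?P Y)" using assms(1) by simp
  finally show ?thesis by (simp add: mult.commute)
qed

text \<open>A uniformly random permutation makes every fixed set uniform among the sets of its size,
  so averages over permutations turn membership indicators into densities.\<close>

lemma sum_permutations_image_mem:
  assumes "finite U" "X \<subseteq> U"
  shows "(\<Sum>\<sigma> | \<sigma> permutes U. of_bool (\<sigma> ` X \<in> \<F>) :: real)
    = fact (card U) * (card (\<F> \<inter> nsets U (card X)) / (card U choose card X))"
proof -
  let ?P = "\<lambda>Z. {\<sigma>. \<sigma> permutes U \<and> \<sigma> ` X = Z}"
  let ?G = "\<F> \<inter> nsets U (card X)"
  have finP: "finite {\<sigma>. \<sigma> permutes U}" using assms(1) by (rule finite_permutations)
  have fin: "finite (?P Z)" for Z by (rule finite_subset[OF _ finP]) auto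
  have pos: "(card U choose card X) > 0"
    using assms by (simp add: card_mono)
  have "{\<sigma>. \<sigma> permutes U} \<inter> {\<sigma>. \<sigma> ` X \<in> \<F>} = (\<Union>Z\<in>?G. ?P Z)"
  proof (intro equalityI subsetI)
    fix \<sigma> assume "\<sigma> \<in> {\<sigma>. \<sigma> permutes U} \<inter> {\<sigma>. \<sigma> ` X \<in> \<F>}"
    then have \<sigma>: "\<sigma> permutes U" "\<sigma> ` X \<in> \<F>" by auto
    have "\<sigma> ` X \<in> nsets U (card X)"
      using \<sigma> assms by (intro permutes_image_mem_nsets)
    then show "\<sigma> \<in> (\<Union>Z\<in>?G. ?P Z)" using \<sigma> by auto
  qed auto
  then have "(\<Sum>\<sigma> | \<sigma> permutes U. of_bool (\<sigma> ` X \<in> \<F>) :: real) = card (\<Union>Z\<in>?G. ?P Z)"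
    using finP by (simp add: sum_of_bool_eq)
  also have "card (\<Union>Z\<in>?G. ?P Z) = (\<Sum>Z\<in>?G. card (?P Z))"
    using fin assms(1) by (intro card_UN_disjoint) (auto simp: finite_imp_finite_nsets)
  also have "real (\<Sum>Z\<in>?G. card (?P Z)) = (\<Sum>Z\<in>?G. fact (card U) / (card U choose card X))"
    unfolding of_nat_sum
  proof (intro sum.cong refl)
    fix Z assume "Z \<in> ?G"
    then have "card (?P Z) * (card U choose card X) = fact (card U)"
      using assms by (intro card_permutations_mapping_subset) (auto simp: nsets_def)
    then have "real (card (?P Z)) * real (card U choose card X) = fact (card U)"
      by (metis of_nat_fact of_nat_mult)
    then show "real (card (?P Z)) = fact (card U) / (card U choose card X)"
      using pos by (simp add: field_simps)
  qed
  finally show ?thesis by simp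
qed

section \<open>Cutting the ground set into cores and increments\<close>

definition block :: "nat \<Rightarrow> nat \<Rightarrow> nat \<Rightarrow> nat set" where
  "block c q i = {c + i * q <.. c + Suc i * q}"

lemma card_block: "card (block c q i) = q"
  by (simp add: block_def)

lemma disjoint_block: "i \<noteq> j \<Longrightarrow> block c q i \<inter> block c q j = {}"
proof (induction i j rule: linorder_wlog)
  case (le i j)
  then have "Suc i * q \<le> j * q" by (intro mult_le_mono1) simp
  then show ?case by (auto simp: block_def)
qed auto

lemma UN_block: "(\<Union>i<r. block c q i) = {c <.. c + r * q}"
proof (induction r)
  case (Suc r)
  then show ?case by (auto simp: block_def lessThan_Suc)
qed simp

theorem theorem3:
  fixes m l k n :: nat and \<F> :: "nat \<Rightarrow> nat set set"
  assumes "m > l" and "l > 0" and "k \<ge> 3" and "n = k * m - l"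
    and "\<And>i. i \<in> {1..k} \<Longrightarrow>
      \<F> i \<subseteq> nsets {1..n} (m - l) \<union> nsets {1..n} m \<union> nsets {1..n} (m + l)"
    and "cross_partition_free n k \<F>"
  shows "(\<Sum>i = 1..k.
            real (card (level n (\<F> i) (m - l))) / real (n choose (m - l))
          + real (card (level n (\<F> i) m)) / real (n choose m)
          + (real k - 2) * (real (card (level n (\<F> i) (m + l))) / real (n choose (m + l))))
         \<le> (real k - 1) * real k"
proof -
  define N where "N = k - 1"
  have k: "k = Suc N" and N: "N \<ge> 2" using assms(3) by (auto simp: N_def)
  define p where "p = m - l"
  have m: "m = p + l" using assms(1) by (simp add: p_def)
  have n: "n = k * p + N * l" using assms(4) by (simp add: m k algebra_simps)
  \<comment> \<open>The cores \<open>P i\<close> and the increments \<open>L j\<close> cut \<open>{1..n}\<close> into consecutive intervals; the sets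
    \<open>C i X\<close> with \<open>card X = 0, 1, 2\<close> have the sizes \<open>m - l\<close>, \<open>m\<close> and \<open>m + l\<close>.\<close>
  define P where "P i = block 0 p (i - 1)" for i
  define L where "L = block (k * p) l"
  have P_UN: "(\<Union>i\<in>{1..k}. P i) = {0<..k * p}"
  proof -
    have "{1..k} = Suc ` {..<k}" by (simp add: lessThan_atLeast0 atLeastLessThanSuc_atLeastAtMost)
    then have "(\<Union>i\<in>{1..k}. P i) = (\<Union>i<k. block 0 p i)" by (simp add: P_def)
    then show ?thesis by (simp add: UN_block)
  qed
  have L_UN: "(\<Union>j<N. L j) = {k * p<..n}" by (simp add: L_def UN_block n)
  have P_disj: "P i \<inter> P i' = {}" if "i \<in> {1..k}" "i' \<in> {1..k}" "i \<noteq> i'" for i i'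
    using that unfolding P_def by (intro disjoint_block) auto
  have L_disj: "L j \<inter> L j' = {}" if "j \<noteq> j'" for j j'
    using that unfolding L_def by (rule disjoint_block)
  have PL_disj: "P i \<inter> L j = {}" if "i \<in> {1..k}" "j < N" for i j
  proof -
    have "P i \<subseteq> {0<..k * p}" "L j \<subseteq> {k * p<..n}" using P_UN L_UN that by blast+
    then show ?thesis by fastforce
  qed
  define C where "C i X = P i \<union> (\<Union>j\<in>X. L j)" for i X
  have C_sub: "C i X \<subseteq> {1..n}" if "i \<in> {1..k}" "X \<subseteq> {..<N}" for i X
  proof -
    have "P i \<subseteq> {0<..k * p}" "(\<Union>j\<in>X. L j) \<subseteq> {k * p<..n}" using P_UN L_UN that by blast+
    then show ?thesis by (fastforce simp: C_def n)
  qed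
  have finite_L: "finite (L j)" and finite_P: "finite (P i)" for i j
    by (simp_all add: L_def P_def block_def)
  have C_card: "card (C i X) = p + card X * l" if "i \<in> {1..k}" "X \<subseteq> {..<N}" for i X
  proof -
    have finX: "finite X" using that finite_subset by blast
    have "card (\<Union>j\<in>X. L j) = card X * l"
      using L_disj finite_L finX by (subst card_UN_disjoint) (auto simp: L_def card_block)
    moreover have "card (C i X) = card (P i) + card (\<Union>j\<in>X. L j)"
      unfolding C_def using PL_disj that finX finite_L finite_P
      by (intro card_Un_disjoint) (auto simp: disjoint_iff subset_iff)
    ultimately show ?thesis by (simp add: P_def card_block)
  qed
  define ok where "ok \<sigma> i X \<longleftrightarrow> \<sigma> ` C i X \<in> \<F> i" for \<sigma> i X
  have costly: "Suc N * N \<le> (\<Sum>i=1..k. \<Sum>j<N. slot_cost N (ok \<sigma>) i j)"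
    if \<sigma>: "\<sigma> permutes {1..n}" for \<sigma>
  proof (rule ccontr)
    assume "\<not> ?thesis"
    then obtain S where S: "\<forall>i\<in>{1..k}. ok \<sigma> i (S i)" "disjoint_family_on S {1..k}"
        "(\<Union>i\<in>{1..k}. S i) = {..<N}"
      using assignment_if_cheap[of "{1..k}" N "ok \<sigma>"] by (auto simp: k)
    have S_sub: "S i \<subseteq> {..<N}" if "i \<in> {1..k}" for i using S(3) that by blast
    have "C i (S i) \<inter> C i' (S i') = {}" if ii: "i \<in> {1..k}" "i' \<in> {1..k}" "i \<noteq> i'" for i i'
    proof -
      have "S i \<inter> S i' = {}" using S(2) ii by (auto simp: disjoint_family_on_def)
      then have "L j \<inter> L j' = {}" if "j \<in> S i" "j' \<in> S i'" for j j'
        using that by (intro L_disj) auto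
      moreover have "P i \<inter> L j' = {}" if "j' \<in> S i'" for j'
        using PL_disj[of i j'] S_sub[of i'] ii that by blast
      moreover have "P i' \<inter> L j = {}" if "j \<in> S i" for j
        using PL_disj[of i' j] S_sub[of i] ii that by blast
      ultimately show ?thesis using P_disj[OF ii] unfolding C_def by blast
    qed
    then have "disjoint_family_on (\<lambda>i. \<sigma> ` C i (S i)) {1..k}"
      by (auto simp: disjoint_family_on_def image_Int[OF permutes_inj[OF \<sigma>], symmetric])
    moreover have "(\<Union>i\<in>{1..k}. \<sigma> ` C i (S i)) = {1..n}"
    proof -
      have "(\<Union>i\<in>{1..k}. C i (S i)) = (\<Union>i\<in>{1..k}. P i) \<union> (\<Union>j\<in>(\<Union>i\<in>{1..k}. S i). L j)"
        by (auto simp: C_def)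
      also have "\<dots> = {1..n}" unfolding S(3) P_UN L_UN by (auto simp: n)
      finally show ?thesis using permutes_image[OF \<sigma>] by (metis image_UN)
    qed
    ultimately have "\<exists>F. (\<forall>i\<in>{1..k}. F i \<in> \<F> i) \<and> disjoint_family_on F {1..k}
        \<and> (\<Union>i\<in>{1..k}. F i) = {1..n}"
      using S(1) by (intro exI[of _ "\<lambda>i. \<sigma> ` C i (S i)"]) (simp add: ok_def)
    then show False using assms(6) by (simp add: cross_partition_free_def)
  qed
  define Q where "Q = {\<sigma>. \<sigma> permutes {1..n}}"
  define d where "d i r = real (card (level n (\<F> i) r)) / real (n choose r)" for i r
  have average: "(\<Sum>\<sigma>\<in>Q. of_bool (ok \<sigma> i X)) = fact n * d i (p + card X * l)"
    if "i \<in> {1..k}" "X \<subseteq> {..<N}" for i X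
    using sum_permutations_image_mem[of "{1..n}" "C i X" "\<F> i"] C_sub[OF that] C_card[OF that]
    by (simp add: Q_def ok_def d_def level_def)
  have slot_sum: "(\<Sum>\<sigma>\<in>Q. real (slot_cost N (ok \<sigma>) i j))
      = fact n * (real k - (d i (m - l) + d i m + (real k - 2) * d i (m + l)))"
    if i: "i \<in> {1..k}" and j: "j < N" for i j
  proof -
    have cQ: "real (card Q) = fact n" using card_permutations[of "{1..n}" n] by (simp add: Q_def)
    have neg: "(\<Sum>\<sigma>\<in>Q. of_bool (\<not> ok \<sigma> i X)) = fact n * (1 - d i (p + card X * l))"
      if "X \<subseteq> {..<N}" for X
      using average[OF i that] cQ by (simp add: of_bool_not_iff sum_subtractf algebra_simps)
    have pair: "(\<Sum>\<sigma>\<in>Q. of_bool (\<not> ok \<sigma> i {j, h})) = fact n * (1 - d i (m + l))"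
      if "h \<in> {..<N} - {j}" for h
      using neg[of "{j, h}"] that j by (simp add: m algebra_simps)
    have "(\<Sum>\<sigma>\<in>Q. real (slot_cost N (ok \<sigma>) i j))
        = (\<Sum>\<sigma>\<in>Q. of_bool (\<not> ok \<sigma> i {})) + (\<Sum>\<sigma>\<in>Q. of_bool (\<not> ok \<sigma> i {j}))
          + (\<Sum>h\<in>{..<N} - {j}. \<Sum>\<sigma>\<in>Q. of_bool (\<not> ok \<sigma> i {j, h}))"
      by (subst sum.swap) (simp add: slot_cost_def sum.distrib)
    also have "\<dots> = fact n * (1 - d i (m - l)) + fact n * (1 - d i m)
        + (\<Sum>h\<in>{..<N} - {j}. fact n * (1 - d i (m + l)))"
      using neg[of "{}"] neg[of "{j}"] j by (simp add: pair m)
    also have "\<dots> = fact n * (1 - d i (m - l)) + fact n * (1 - d i m)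
        + (real k - 2) * (fact n * (1 - d i (m + l)))"
      using j N by (simp add: k of_nat_diff)
    finally show ?thesis by (simp add: algebra_simps)
  qed
  let ?w = "\<lambda>i. d i (m - l) + d i m + (real k - 2) * d i (m + l)"
  have "fact n * (real k * real N) = (\<Sum>\<sigma>\<in>Q. real (Suc N * N))"
    using card_permutations[of "{1..n}" n] by (simp add: Q_def k algebra_simps)
  also have "\<dots> \<le> (\<Sum>\<sigma>\<in>Q. real (\<Sum>i=1..k. \<Sum>j<N. slot_cost N (ok \<sigma>) i j))"
    using costly by (intro sum_mono of_nat_mono) (simp add: Q_def)
  also have "\<dots> = (\<Sum>\<sigma>\<in>Q. \<Sum>i=1..k. \<Sum>j<N. real (slot_cost N (ok \<sigma>) i j))" by simp
  also have "\<dots> = (\<Sum>i=1..k. \<Sum>\<sigma>\<in>Q. \<Sum>j<N. real (slot_cost N (ok \<sigma>) i j))" by (rule sum.swap)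
  also have "\<dots> = (\<Sum>i=1..k. \<Sum>j<N. \<Sum>\<sigma>\<in>Q. real (slot_cost N (ok \<sigma>) i j))"
    by (intro sum.cong refl sum.swap)
  also have "\<dots> = (\<Sum>i=1..k. \<Sum>j<N. fact n * (real k - ?w i))"
    by (intro sum.cong refl slot_sum) auto
  also have "\<dots> = fact n * (real N * (\<Sum>i=1..k. real k - ?w i))"
    by (simp add: sum_distrib_left mult.left_commute)
  finally have "real N * real k \<le> real N * (\<Sum>i=1..k. real k - ?w i)" by (simp add: mult.commute)
  then have "real k \<le> (\<Sum>i=1..k. real k - ?w i)" using N by simp
  then have "(\<Sum>i=1..k. ?w i) \<le> real k * real k - real k"
    by (simp only: sum_subtractf) simp
  then show ?thesis by (simp add: d_def algebra_simps)
qed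

end
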